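(* Let $n\ge 0$ be an integer, $\nu\in\mathbb{R}$, and $t\in\mathbb{C}$ with $\Re t>0$. Then the $n$-th derivative with respect to the order of the modified Bessel function of the first kind is $$\frac{\partial^{n}}{\partial\nu^{n}}I_{\nu}(t)=\frac{1}{\pi}\int_{0}^{\pi}x^{n}e^{t\cos x}\cos\left(\nu x+\frac{\pi}{2}n\right)dx-\frac{1}{\pi}\int_{0}^{\infty}e^{-t\cosh x-\nu x}\,\Im\left[(i\pi-x)^{n}e^{i\pi\nu}\right]dx .$$
   Context: $I_\nu(t)=\left(\frac t2\right)^{\nu}\sum_{k=0}^{\infty}\frac{(t/2)^{2k}}{k!\,\Gamma(\nu+k+1)}$ is the modified Bessel function of the first kind (principal branch of the power, $1/\Gamma$ taken to be $0$ at the poles of $\Gamma$). $\Im$ denotes the imaginary part. *)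

theory Defs
  imports "HOL-Analysis.Analysis"
begin

text \<open>Modified Bessel function of the first kind. The power is the principal branch, and
  \<^const>\<open>rGamma\<close> is the entire function \<open>1/\<Gamma>\<close>, which vanishes at the poles of \<open>\<Gamma>\<close>.\<close>

definition bessel_I :: "complex \<Rightarrow> complex \<Rightarrow> complex" where
  "bessel_I \<nu> t =
     (t / 2) powr \<nu> * (\<Sum>k. (t / 2) ^ (2 * k) / fact k * rGamma (\<nu> + of_nat k + 1))"

text \<open>Only meaningful where all lower iterates are differentiable, since
  \<^const>\<open>vector_derivative\<close> is unspecified elsewhere.\<close>

definition nth_vector_derivative ::
    "nat \<Rightarrow> (real \<Rightarrow> 'a::real_normed_vector) \<Rightarrow> real \<Rightarrow> 'a" where
  "nth_vector_derivative n f = ((\<lambda>g x. vector_derivative g (at x)) ^^ n) f"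

end

theory Submission
  imports Defs
begin

text \<open>
  Write \<open>H f\<close> for \<open>1 / (2 \<pi> i)\<close> times the integral of \<open>f\<close> over the Hankel contour that comes
  in from \<open>\<infinity> - i \<pi>\<close>, passes through \<open>- i \<pi>\<close>, \<open>0\<close> and \<open>i \<pi>\<close>, and leaves to \<open>\<infinity> + i \<pi>\<close>. Then
  \<open>h(\<nu>) = H (exp (r e\<^sup>w - \<nu> w))\<close> equals \<open>r\<^sup>\<nu> / \<Gamma>(\<nu> + 1)\<close>: integrating the derivative of the
  integrand gives \<open>r h(\<nu> - 1) = \<nu> h(\<nu>)\<close>, and \<open>\<partial>h(\<nu>)/\<partial>r = h(\<nu> - 1)\<close>, so \<open>h(\<nu>) / r\<^sup>\<nu>\<close> does not
  depend on \<open>r\<close>; letting \<open>r\<close> tend to \<open>0\<close> identifies the constant for \<open>-1 < \<nu> \<le> 0\<close> through Euler's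
  integral and the reflection formula, and the recurrence does the rest. Expanding
  \<open>exp (r exp (- w))\<close> termwise turns this into
  \<open>I\<^sub>\<nu>(2 r) = H (exp (r exp w + r exp (- w) - \<nu> w))\<close>, and differentiating \<open>n\<close> times in \<open>\<nu>\<close>
  under the integral sign multiplies the integrand by \<open>(- w)\<^sup>n\<close>.
\<close>

section \<open>Differentiation and termwise summation under the integral sign\<close>

text \<open>\<open>exp (Re a * \<mu>)\<close> is monotone in \<open>\<mu>\<close>, so one endpoint
  dominates, which one depending on the sign of \<open>Re a\<close>. The sum of both serves either
  sign and gives a majorant that does not depend on \<open>\<mu>\<close>.\<close>

lemma norm_mult_exp_le_endpoints:
  fixes g a :: complex and \<mu> \<nu> \<delta> :: real
  assumes "\<bar>\<mu> - \<nu>\<bar> \<le> \<delta>"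
  shows "norm (g * exp (a * of_real \<mu>)) \<le>
    norm (g * exp (a * of_real (\<nu> - \<delta>))) + norm (g * exp (a * of_real (\<nu> + \<delta>)))"
proof -
  have "exp (Re a * \<mu>) \<le> exp (Re a * (\<nu> - \<delta>)) + exp (Re a * (\<nu> + \<delta>))"
  proof (cases "Re a \<ge> 0")
    case True
    then have "Re a * \<mu> \<le> Re a * (\<nu> + \<delta>)"
      using assms by (intro mult_left_mono) auto
    then show ?thesis
      by (simp add: add_increasing)
  next
    case False
    then have "Re a * \<mu> \<le> Re a * (\<nu> - \<delta>)"
      using assms by (intro mult_left_mono_neg) auto
    then show ?thesis
      by (simp add: add_increasing2)
  qed
  then have "norm g * exp (Re a * \<mu>) \<le> norm g * (exp (Re a * (\<nu> - \<delta>)) + exp (Re a * (\<nu> + \<delta>)))"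
    by (intro mult_left_mono) auto
  then show ?thesis
    by (simp add: norm_mult distrib_left)
qed

lemma has_vector_derivative_mult_exp:
  fixes g a :: complex
  shows "((\<lambda>\<mu>. g * exp (a * of_real \<mu>)) has_vector_derivative g * a * exp (a * of_real \<nu>)) (at \<nu> within S)"
proof -
  have "((\<lambda>z. g * exp (a * z)) has_field_derivative g * a * exp (a * of_real \<nu>)) (at (of_real \<nu>))"
    by (auto intro!: derivative_eq_intros simp: mult_ac)
  then show ?thesis
    by (intro has_vector_derivative_at_within[OF has_vector_derivative_real_field])
qed

text \<open>Dominated convergence for the normalised first-order remainder of the integrand. The
  mean value inequality bounds the remainder by the \<open>\<mu>\<close>-derivative of the
  integrand, and the previous endpoint estimate makes that bound an integrable function built from
  \<open>int'\<close> at \<open>\<nu> - \<delta>\<close> and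
  \<open>\<nu> + \<delta>\<close>.\<close>

lemma has_vector_derivative_integral_exp:
  fixes f a :: "'x \<Rightarrow> complex" and \<nu> \<delta> :: real
  assumes "\<delta> > 0"
    and int: "\<And>\<mu>. \<bar>\<mu> - \<nu>\<bar> \<le> \<delta> \<Longrightarrow> integrable M (\<lambda>x. f x * exp (a x * of_real \<mu>))"
    and int': "\<And>\<mu>. \<bar>\<mu> - \<nu>\<bar> \<le> \<delta> \<Longrightarrow> integrable M (\<lambda>x. f x * a x * exp (a x * of_real \<mu>))"
  shows "((\<lambda>\<mu>. \<integral>x. f x * exp (a x * of_real \<mu>) \<partial>M) has_vector_derivative
    (\<integral>x. f x * a x * exp (a x * of_real \<nu>) \<partial>M)) (at \<nu>)"
proof -
  define D where "D = (\<integral>x. f x * a x * exp (a x * of_real \<nu>) \<partial>M)"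
  define F where "F \<mu> = (\<integral>x. f x * exp (a x * of_real \<mu>) \<partial>M)" for \<mu>
  \<comment> \<open>The claim is exactly that the integral of \<open>q \<mu>\<close> tends to 0 as
    \<open>\<mu>\<close> tends to \<open>\<nu>\<close>.\<close>
  define q where "q \<mu> x = (1 / norm (\<mu> - \<nu>)) *\<^sub>R (f x * exp (a x * of_real \<mu>) -
    (f x * exp (a x * of_real \<nu>) + (\<mu> - \<nu>) *\<^sub>R (f x * a x * exp (a x * of_real \<nu>))))" for \<mu> x
  \<comment> \<open>The factor 2 arises because the linearization bound compares the derivative at
    \<open>z\<close> with the one at \<open>\<nu>\<close>, and each is dominated by the same
    endpoint sum.\<close>
  define w where "w x = 2 * (norm (f x * a x * exp (a x * of_real (\<nu> - \<delta>))) +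
    norm (f x * a x * exp (a x * of_real (\<nu> + \<delta>))))" for x
  have int_q: "integrable M (q \<mu>)" if "\<bar>\<mu> - \<nu>\<bar> \<le> \<delta>" for \<mu>
    unfolding q_def using that \<open>\<delta> > 0\<close>
    by (intro integrable_scaleR_right Bochner_Integration.integrable_diff
        Bochner_Integration.integrable_add int int') auto
  have q_eq: "(\<integral>x. q \<mu> x \<partial>M) = (1 / norm (\<mu> - \<nu>)) *\<^sub>R (F \<mu> - (F \<nu> + (\<mu> - \<nu>) *\<^sub>R D))"
    if "\<bar>\<mu> - \<nu>\<bar> \<le> \<delta>" for \<mu>
    using int[OF that] int'[of \<nu>] int[of \<nu>] \<open>\<delta> > 0\<close> by (simp add: q_def F_def D_def)
  have bound: "norm (q \<mu> x) \<le> w x" if "\<bar>\<mu> - \<nu>\<bar> \<le> \<delta>" "\<mu> \<noteq> \<nu>" for \<mu> x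
  proof -
    have "norm (f x * exp (a x * of_real \<mu>) - f x * exp (a x * of_real \<nu>) -
        (\<mu> - \<nu>) *\<^sub>R (f x * a x * exp (a x * of_real \<nu>))) \<le> norm (\<mu> - \<nu>) * w x"
    proof (rule vector_differentiable_bound_linearization[where S = "{\<nu> - \<delta>..\<nu> + \<delta>}"
          and f' = "\<lambda>\<mu>. f x * a x * exp (a x * of_real \<mu>)"])
      show "closed_segment \<nu> \<mu> \<subseteq> {\<nu> - \<delta>..\<nu> + \<delta>}"
        using that by (auto simp: closed_segment_eq_real_ivl split: if_splits)
      show "norm (f x * a x * exp (a x * of_real z) - f x * a x * exp (a x * of_real \<nu>)) \<le> w x"
        if "z \<in> {\<nu> - \<delta>..\<nu> + \<delta>}" for z
        using norm_mult_exp_le_endpoints[of z \<nu> \<delta> "f x * a x" "a x"]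
          norm_mult_exp_le_endpoints[of \<nu> \<nu> \<delta> "f x * a x" "a x"] that \<open>\<delta> > 0\<close>
        unfolding w_def
        by (intro order_trans[OF norm_triangle_ineq4]) (simp add: abs_le_iff)
    qed (use \<open>\<delta> > 0\<close> in \<open>auto intro: has_vector_derivative_mult_exp\<close>)
    then have "norm (f x * exp (a x * of_real \<mu>) - f x * exp (a x * of_real \<nu>) -
        (\<mu> - \<nu>) *\<^sub>R (f x * a x * exp (a x * of_real \<nu>))) / norm (\<mu> - \<nu>) \<le> w x"
      using that(2) by (simp add: pos_divide_le_eq mult.commute)
    then show ?thesis
      unfolding q_def diff_diff_eq[symmetric] by (simp add: abs_divide)
  qed
  have lim: "((\<lambda>\<mu>. q \<mu> x) \<longlongrightarrow> 0) (at \<nu>)" for x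
    using has_vector_derivative_mult_exp[of "f x" "a x" \<nu> UNIV]
    unfolding has_vector_derivative_def has_derivative_within q_def by blast
  have "((\<lambda>\<mu>. (1 / norm (\<mu> - \<nu>)) *\<^sub>R (F \<mu> - (F \<nu> + (\<mu> - \<nu>) *\<^sub>R D))) \<longlongrightarrow> 0) (at \<nu>)"
    unfolding tendsto_at_iff_sequentially
  proof (intro allI impI)
    fix X :: "nat \<Rightarrow> real" assume X: "\<forall>i. X i \<in> UNIV - {\<nu>}" and X_lim: "X \<longlonglongrightarrow> \<nu>"
    then have "\<forall>\<^sub>F i in sequentially. dist (X i) \<nu> < \<delta>"
      using \<open>\<delta> > 0\<close> by (intro tendstoD)
    then obtain N where N: "\<And>i. i \<ge> N \<Longrightarrow> \<bar>X i - \<nu>\<bar> \<le> \<delta>"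
      by (auto simp: eventually_sequentially dist_real_def intro: less_imp_le)
    \<comment> \<open>The domination by \<open>w\<close> holds only within distance
      \<open>\<delta>\<close> of \<open>\<nu>\<close>, hence the shift of the sequence by
      \<open>N\<close>, undone at the end by \<open>LIMSEQ_offset\<close>.\<close>
    have "(\<lambda>i. \<integral>x. q (X (i + N)) x \<partial>M) \<longlonglongrightarrow> (\<integral>x. 0 \<partial>M)"
    proof (rule integral_dominated_convergence[where w = w])
      show "integrable M w"
        unfolding w_def using int'[of "\<nu> - \<delta>"] int'[of "\<nu> + \<delta>"] \<open>\<delta> > 0\<close> by auto
      show "AE x in M. (\<lambda>i. q (X (i + N)) x) \<longlonglongrightarrow> 0"
        using lim X X_lim unfolding tendsto_at_iff_sequentially comp_def
        by (auto intro!: LIMSEQ_ignore_initial_segment)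
      show "q (X (i + N)) \<in> borel_measurable M" for i
        using int_q[OF N, of "i + N"] by auto
      show "AE x in M. norm (q (X (i + N)) x) \<le> w x" for i
        using bound[OF N, of "i + N"] X by auto
    qed auto
    then have "(\<lambda>i. (1 / norm (X (i + N) - \<nu>)) *\<^sub>R (F (X (i + N)) - (F \<nu> + (X (i + N) - \<nu>) *\<^sub>R D))) \<longlonglongrightarrow> 0"
      by (subst (asm) q_eq) (auto intro: N)
    then show "((\<lambda>\<mu>. (1 / norm (\<mu> - \<nu>)) *\<^sub>R (F \<mu> - (F \<nu> + (\<mu> - \<nu>) *\<^sub>R D))) \<circ> X) \<longlonglongrightarrow> 0"
      unfolding comp_def by (rule LIMSEQ_offset)
  qed
  then show ?thesis
    unfolding has_vector_derivative_def has_derivative_within F_def D_def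
    by (auto intro: bounded_linear_scaleR_left)
qed

text \<open>Since \<open>v\<close> is at most 1 in norm wherever \<open>f\<close> is nonzero, the
  exponential series of \<open>norm c\<close> times \<open>norm (f x)\<close> majorises the terms,
  and sum and integral may be exchanged. Restricting the condition on \<open>v\<close> to the
  support of \<open>f\<close> lets the indicator of a set be absorbed into \<open>f\<close>.\<close>

lemma integral_exp_sums:
  fixes f v :: "'x \<Rightarrow> complex"
  assumes int: "\<And>k. integrable M (\<lambda>x. f x * v x ^ k)"
    and v: "\<And>x. f x \<noteq> 0 \<Longrightarrow> norm (v x) \<le> 1"
  shows "(\<lambda>k. c ^ k / fact k * (\<integral>x. f x * v x ^ k \<partial>M)) sums (\<integral>x. f x * exp (c * v x) \<partial>M)"
proof -
  have bound: "norm (c ^ k / fact k * (f x * v x ^ k)) \<le> norm (f x) * (norm c ^ k / fact k)" for k x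
  proof (cases "f x = 0")
    case False
    have "norm (v x) ^ k \<le> 1"
      using v[OF False] by (simp add: power_le_one)
    then have "norm c ^ k / fact k * norm (f x) * norm (v x) ^ k \<le> norm c ^ k / fact k * norm (f x) * 1"
      by (intro mult_left_mono) auto
    then show ?thesis
      by (simp add: norm_mult norm_divide norm_power mult_ac)
  qed simp
  have summable_c: "summable (\<lambda>k. norm c ^ k / fact k)"
    using summable_exp[of "norm c"] by (simp add: divide_inverse mult.commute)
  have "(\<lambda>k. \<integral>x. c ^ k / fact k * (f x * v x ^ k) \<partial>M) sums
      (\<integral>x. (\<Sum>k. c ^ k / fact k * (f x * v x ^ k)) \<partial>M)"
  proof (rule sums_integral)
    show "integrable M (\<lambda>x. c ^ k / fact k * (f x * v x ^ k))" for k
      using int by simp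
    show "AE x in M. summable (\<lambda>k. norm (c ^ k / fact k * (f x * v x ^ k)))"
      by (intro AE_I2 summable_comparison_test[OF _ summable_mult[OF summable_c]])
        (use bound in auto)
    show "summable (\<lambda>k. \<integral>x. norm (c ^ k / fact k * (f x * v x ^ k)) \<partial>M)"
    proof (rule summable_comparison_test[OF _ summable_mult[OF summable_c]])
      have "norm (\<integral>x. norm (c ^ k / fact k * (f x * v x ^ k)) \<partial>M) \<le>
          (\<integral>x. norm (f x) \<partial>M) * (norm c ^ k / fact k)" for k
      proof -
        have "(\<integral>x. norm (c ^ k / fact k * (f x * v x ^ k)) \<partial>M) \<le>
            (\<integral>x. norm (f x) * (norm c ^ k / fact k) \<partial>M)"
          using int[of k] int[of 0] by (intro integral_mono bound) simp_all
        moreover have "0 \<le> (\<integral>x. norm (c ^ k / fact k * (f x * v x ^ k)) \<partial>M)"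
          by (intro integral_nonneg_AE AE_I2 norm_ge_zero)
        ultimately show ?thesis
          by (simp only: real_norm_def abs_of_nonneg integral_mult_left_zero)
      qed
      then show "\<exists>N. \<forall>k\<ge>N. norm (\<integral>x. norm (c ^ k / fact k * (f x * v x ^ k)) \<partial>M) \<le>
          (\<integral>x. norm (f x) \<partial>M) * (norm c ^ k / fact k)"
        by blast
    qed
  qed
  moreover have "(\<Sum>k. c ^ k / fact k * (f x * v x ^ k)) = f x * exp (c * v x)" for x
  proof -
    have "(\<lambda>k. f x * ((c * v x) ^ k /\<^sub>R fact k)) sums (f x * exp (c * v x))"
      by (intro sums_mult exp_converges)
    then show ?thesis
      by (intro sums_unique[symmetric]) (simp add: power_mult_distrib scaleR_conv_of_real divide_inverse mult_ac)
  qed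
  ultimately show ?thesis
    by simp
qed

section \<open>Integration along the Hankel contour\<close>

definition hankel_integrable :: "(complex \<Rightarrow> complex) \<Rightarrow> bool" where
  "hankel_integrable f \<longleftrightarrow>
     set_integrable lborel {0..pi} (\<lambda>x. f (\<i> * of_real x)) \<and>
     set_integrable lborel {0..pi} (\<lambda>x. f (- \<i> * of_real x)) \<and>
     set_integrable lborel {0..} (\<lambda>x. f (of_real x + \<i> * of_real pi)) \<and>
     set_integrable lborel {0..} (\<lambda>x. f (of_real x - \<i> * of_real pi))"

text \<open>Both segments carry \<open>+\<i>\<close>: on the lower one the parametrisation
  \<open>- \<i> * x\<close> has derivative \<open>-\<i>\<close> but runs against the contour, and
  the two signs cancel. The lower ray is traversed inward from infinity, hence the minus
  sign.\<close>

definition hankel_integral :: "(complex \<Rightarrow> complex) \<Rightarrow> complex" where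
  "hankel_integral f =
     (\<i> * (LBINT x:{0..pi}. f (\<i> * of_real x)) + \<i> * (LBINT x:{0..pi}. f (- \<i> * of_real x)) +
      (LBINT x:{0..}. f (of_real x + \<i> * of_real pi)) -
      (LBINT x:{0..}. f (of_real x - \<i> * of_real pi))) / (2 * of_real pi * \<i>)"

lemma power_le_fact_mult_exp:
  fixes x :: real
  assumes "x \<ge> 0"
  shows "x ^ n \<le> fact n * exp x"
proof -
  have "sum (\<lambda>k. x ^ k /\<^sub>R fact k) {n} \<le> exp x"
    unfolding exp_def using assms by (intro sum_le_suminf summable_exp_generic) auto
  then show ?thesis
    by (simp add: field_simps)
qed

lemma set_integrable_exp_minus: "set_integrable lborel {0..} (\<lambda>x::real. exp (- x))"
proof -
  have "set_integrable lebesgue {0..} (\<lambda>x::real. exp (- x))"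
    using integrable_on_exp_minus_to_infinity[of 1 0]
    by (intro nonnegative_absolutely_integrable_1) auto
  then show ?thesis
    unfolding set_integrable_def by (subst (asm) integrable_completion) auto
qed

lemma set_integral_FTC_atLeast:
  fixes F f :: "real \<Rightarrow> complex"
  assumes F: "\<And>x. (F has_vector_derivative f x) (at x)" and f: "continuous_on UNIV f"
    and int: "set_integrable lborel {a..} f" and lim: "(F \<longlongrightarrow> L) at_top"
  shows "(LBINT x:{a..}. f x) = L - F a"
proof (rule tendsto_unique[OF trivial_limit_at_top_linorder])
  show "((\<lambda>b. LBINT x:{a..b}. f x) \<longlongrightarrow> (LBINT x:{a..}. f x)) at_top"
    using int by (intro tendsto_set_lebesgue_integral_at_top) auto
  have "((\<lambda>b. F b - F a) \<longlongrightarrow> L - F a) at_top"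
    using lim by (intro tendsto_intros)
  moreover have "\<forall>\<^sub>F b in at_top. F b - F a = (LBINT x:{a..b}. f x)"
    using eventually_ge_at_top[of a]
  proof eventually_elim
    case (elim b)
    then show ?case
      unfolding set_lebesgue_integral_def
      using F f by (intro integral_FTC_Icc[symmetric])
        (auto intro: has_vector_derivative_at_within continuous_on_subset)
  qed
  ultimately show "((\<lambda>b. LBINT x:{a..b}. f x) \<longlongrightarrow> L - F a) at_top"
    by (rule Lim_transform_eventually)
qed

lemma has_vector_derivative_affine_comp:
  assumes "(f has_field_derivative f') (at (a + b * of_real x))"
  shows "((\<lambda>x. f (a + b * of_real x)) has_vector_derivative b * f') (at x within S)"
proof -
  have "((\<lambda>z. f (a + b * z)) has_field_derivative f' * b) (at (of_real x))"
    by (rule DERIV_chain2[where f = f and g = "\<lambda>z. a + b * z", OF assms])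
      (auto intro!: derivative_eq_intros)
  then show ?thesis
    using has_vector_derivative_real_field[of "\<lambda>z. f (a + b * z)" "f' * b" x S]
    by (simp add: mult.commute)
qed

text \<open>The fundamental theorem of calculus on each of the four pieces; the values at
  \<open>0\<close>, \<open>\<i> * pi\<close> and \<open>- \<i> * pi\<close> cancel between
  neighbouring pieces, and \<open>lim\<close> removes the two ends at infinity.\<close>

lemma hankel_integral_deriv_eq_0:
  assumes deriv: "\<And>w. (f has_field_derivative f' w) (at w)"
    and cont: "continuous_on UNIV f'"
    and int: "hankel_integrable f'"
    and lim: "((\<lambda>x. f (of_real x + \<i> * of_real pi)) \<longlongrightarrow> 0) at_top"
      "((\<lambda>x. f (of_real x - \<i> * of_real pi)) \<longlongrightarrow> 0) at_top"
  shows "hankel_integral f' = 0"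
proof -
  have vd: "((\<lambda>x. f (a + b * of_real x)) has_vector_derivative b * f' (a + b * of_real x)) (at x within S)"
    for a b x S
    by (rule has_vector_derivative_affine_comp[OF deriv])
  have cont': "continuous_on S (\<lambda>x. b * f' (a + b * complex_of_real x))" for a b S
    by (intro continuous_intros continuous_on_compose2[OF cont]) auto
  have arc: "b * (LBINT x:{0..pi}. f' (b * of_real x)) = f (b * of_real pi) - f 0" for b
  proof -
    have "(LBINT x:{0..pi}. b * f' (b * of_real x)) = f (b * of_real pi) - f 0"
      unfolding set_lebesgue_integral_def
      using integral_FTC_Icc[where a = 0 and b = pi and f = "\<lambda>x. b * f' (0 + b * of_real x)", OF _ vd cont'] by simp
    then show ?thesis
      by simp
  qed
  have arc2: "\<i> * (LBINT x:{0..pi}. f' (- \<i> * of_real x)) = f 0 - f (- (\<i> * of_real pi))"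
    using arc[of "- \<i>"] by (simp add: algebra_simps)
  have ray1: "(LBINT x:{0..}. f' (of_real x + \<i> * of_real pi)) = 0 - f (\<i> * of_real pi)"
    using set_integral_FTC_atLeast[where a = 0 and f = "\<lambda>x. 1 * f' (\<i> * of_real pi + 1 * of_real x)", OF vd cont'] int lim(1)
    by (simp add: hankel_integrable_def add.commute)
  have ray2: "(LBINT x:{0..}. f' (of_real x - \<i> * of_real pi)) = 0 - f (- (\<i> * of_real pi))"
    using set_integral_FTC_atLeast[where a = 0 and f = "\<lambda>x. 1 * f' (- (\<i> * of_real pi) + 1 * of_real x)", OF vd cont'] int lim(2)
    by (simp add: hankel_integrable_def add.commute)
  show ?thesis
    using arc[of \<i>] arc2 unfolding hankel_integral_def ray1 ray2 by simp
qed

lemma hankel_integral_add: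
  assumes "hankel_integrable f" "hankel_integrable g"
  shows "hankel_integral (\<lambda>w. f w + g w) = hankel_integral f + hankel_integral g"
  using assms unfolding hankel_integrable_def hankel_integral_def
  by (simp add: algebra_simps add_divide_distrib diff_divide_distrib)

lemma hankel_integrable_add:
  "hankel_integrable f \<Longrightarrow> hankel_integrable g \<Longrightarrow> hankel_integrable (\<lambda>w. f w + g w)"
  unfolding hankel_integrable_def by simp

lemma hankel_integral_cmult: "hankel_integral (\<lambda>w. c * f w) = c * hankel_integral f"
  unfolding hankel_integral_def by (simp add: algebra_simps add_divide_distrib diff_divide_distrib)

lemma hankel_integrable_cmult: "hankel_integrable f \<Longrightarrow> hankel_integrable (\<lambda>w. c * f w)"
  unfolding hankel_integrable_def by simp

lemma has_vector_derivative_set_integral_exp: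
  fixes f a :: "'x \<Rightarrow> complex" and \<nu> \<delta> :: real
  assumes "\<delta> > 0"
    and int: "\<And>\<mu>. \<bar>\<mu> - \<nu>\<bar> \<le> \<delta> \<Longrightarrow> set_integrable M A (\<lambda>x. f x * exp (a x * of_real \<mu>))"
    and int': "\<And>\<mu>. \<bar>\<mu> - \<nu>\<bar> \<le> \<delta> \<Longrightarrow> set_integrable M A (\<lambda>x. f x * a x * exp (a x * of_real \<mu>))"
  shows "((\<lambda>\<mu>. \<integral>x\<in>A. f x * exp (a x * of_real \<mu>) \<partial>M) has_vector_derivative
    (\<integral>x\<in>A. f x * a x * exp (a x * of_real \<nu>) \<partial>M)) (at \<nu>)"
  using has_vector_derivative_integral_exp[OF \<open>\<delta> > 0\<close>, where f = "\<lambda>x. of_real (indicator A x) * f x" and a = a]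
    int int' unfolding set_integrable_def set_lebesgue_integral_def
  by (simp add: scaleR_conv_of_real mult.assoc)

lemma has_vector_derivative_hankel_integral_exp:
  assumes "\<delta> > 0"
    and int: "\<And>\<mu>. \<bar>\<mu> - \<nu>\<bar> \<le> \<delta> \<Longrightarrow> hankel_integrable (\<lambda>w. f w * exp (a w * of_real \<mu>))"
    and int': "\<And>\<mu>. \<bar>\<mu> - \<nu>\<bar> \<le> \<delta> \<Longrightarrow> hankel_integrable (\<lambda>w. f w * a w * exp (a w * of_real \<mu>))"
  shows "((\<lambda>\<mu>. hankel_integral (\<lambda>w. f w * exp (a w * of_real \<mu>))) has_vector_derivative
    hankel_integral (\<lambda>w. f w * a w * exp (a w * of_real \<nu>))) (at \<nu>)"
  unfolding hankel_integral_def
  using int int' unfolding hankel_integrable_def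
  by (intro has_vector_derivative_divide has_vector_derivative_add has_vector_derivative_diff
      has_vector_derivative_mult_right has_vector_derivative_set_integral_exp[OF \<open>\<delta> > 0\<close>]) blast+

lemma set_integral_exp_sums:
  fixes f v :: "'x \<Rightarrow> complex"
  assumes int: "\<And>k. set_integrable M A (\<lambda>x. f x * v x ^ k)"
    and v: "\<And>x. x \<in> A \<Longrightarrow> norm (v x) \<le> 1"
  shows "(\<lambda>k. c ^ k / fact k * (\<integral>x\<in>A. f x * v x ^ k \<partial>M)) sums (\<integral>x\<in>A. f x * exp (c * v x) \<partial>M)"
  using integral_exp_sums[where f = "\<lambda>x. of_real (indicator A x) * f x" and v = v and c = c and M = M] int v
  unfolding set_integrable_def set_lebesgue_integral_def
  by (simp add: scaleR_conv_of_real mult.assoc indicator_def split: if_splits)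

text \<open>The contour lies in the half-plane \<open>Re w \<ge> 0\<close>, where
  \<open>exp (- w)\<close> has norm at most 1, so the exchange of sum and integral applies on each
  piece.\<close>

lemma hankel_integral_exp_sums:
  assumes int: "\<And>k. hankel_integrable (\<lambda>w. f w * exp (- w) ^ k)"
  shows "(\<lambda>k. c ^ k / fact k * hankel_integral (\<lambda>w. f w * exp (- w) ^ k)) sums
    hankel_integral (\<lambda>w. f w * exp (c * exp (- w)))"
proof -
  note sums = set_integral_exp_sums[where c = c]
  have "(\<lambda>k. (\<i> * (c ^ k / fact k * (LBINT x:{0..pi}. f (\<i> * of_real x) * exp (- (\<i> * of_real x)) ^ k)) +
      \<i> * (c ^ k / fact k * (LBINT x:{0..pi}. f (- \<i> * of_real x) * exp (- (- \<i> * of_real x)) ^ k)) +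
      (c ^ k / fact k * (LBINT x:{0..}. f (of_real x + \<i> * of_real pi) * exp (- (of_real x + \<i> * of_real pi)) ^ k)) -
      (c ^ k / fact k * (LBINT x:{0..}. f (of_real x - \<i> * of_real pi) * exp (- (of_real x - \<i> * of_real pi)) ^ k))) /
      (2 * of_real pi * \<i>)) sums hankel_integral (\<lambda>w. f w * exp (c * exp (- w)))"
    unfolding hankel_integral_def using int unfolding hankel_integrable_def
    by (intro sums_divide sums_add sums_diff sums_mult sums) auto
  then show ?thesis
    unfolding hankel_integral_def by (simp add: algebra_simps)
qed

section \<open>The kernel: decay, integrability and algebra\<close>

text \<open>One family for both uses: \<open>q = 0\<close> gives the integrand for the reciprocal
  Gamma function and \<open>q = r\<close> the one for the Bessel function, while \<open>n\<close>
  counts derivatives in \<open>\<nu>\<close>.\<close>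

definition hankel_kernel :: "nat \<Rightarrow> complex \<Rightarrow> complex \<Rightarrow> real \<Rightarrow> complex \<Rightarrow> complex" where
  "hankel_kernel n r q \<nu> w = (- w) ^ n * exp (r * exp w + q * exp (- w) - of_real \<nu> * w)"

text \<open>The condition on \<open>exp w\<close> describes both rays at once. There
  \<open>r * exp w\<close> has real part \<open>- Re r * exp (Re w)\<close>, and this doubly
  exponential decay beats the power of \<open>w\<close> and the factor coming from
  \<open>\<nu>\<close>.\<close>

lemma hankel_kernel_bound:
  assumes "Re r > 0"
  shows "\<exists>K. \<forall>w. Re w \<ge> 0 \<and> \<bar>Im w\<bar> \<le> pi \<and> exp w = - of_real (exp (Re w)) \<longrightarrow>
    norm (hankel_kernel n r q \<nu> w) \<le> K * exp (- Re w)"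
proof -
  \<comment> \<open>The double exponential is weakened below to a multiple of
    \<open>exp (- m * y)\<close>, where \<open>y = Re w\<close>. With
    \<open>m \<ge> \<bar>\<nu>\<bar> + 2\<close> this absorbs \<open>exp (- \<nu> * y)\<close> and
    the \<open>exp y\<close> that bounds the power of \<open>w\<close>, and still leaves
    \<open>exp (- y)\<close>.\<close>
  define m where "m = nat \<lceil>\<bar>\<nu>\<bar>\<rceil> + 2"
  have m: "\<bar>\<nu>\<bar> + 2 \<le> real m"
    unfolding m_def by linarith
  define K where "K = fact n * exp (pi + norm q) * (fact m / Re r ^ m)"
  have "norm (hankel_kernel n r q \<nu> w) \<le> K * exp (- Re w)"
    if w: "Re w \<ge> 0" "\<bar>Im w\<bar> \<le> pi" "exp w = - of_real (exp (Re w))" for w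
  proof -
    define y where "y = Re w"
    have "norm w \<le> y + pi"
      using cmod_le[of w] w by (simp add: y_def)
    then have pow: "norm w ^ n \<le> fact n * exp (y + pi)"
      by (intro order_trans[OF power_le_fact_mult_exp]) auto
    have "Re (q * exp (- w)) \<le> norm q * exp (- y)"
      using complex_Re_le_cmod[of "q * exp (- w)"] by (simp add: norm_mult y_def)
    also have "\<dots> \<le> norm q * 1"
      using w(1) by (intro mult_left_mono) (auto simp: y_def)
    finally have q: "Re (q * exp (- w)) \<le> norm q"
      by simp
    have "\<nu> * y \<ge> - (\<bar>\<nu>\<bar> * y)" "(\<bar>\<nu>\<bar> + 2) * y \<le> real m * y"
      using w(1) m by (auto simp: y_def abs_mult intro!: mult_right_mono) (smt (verit) mult_minus_left mult_right_mono)
    then have lin: "norm q - \<nu> * y + (y + pi) - real m * y \<le> pi + norm q - y"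
      by (simp add: algebra_simps)
    have "(Re r * exp y) ^ m \<le> fact m * exp (Re r * exp y)"
      using assms by (intro power_le_fact_mult_exp) auto
    then have r: "exp (- (Re r * exp y)) \<le> fact m / Re r ^ m * exp (- (real m * y))"
      using assms by (simp add: exp_minus power_mult_distrib field_simps flip: exp_of_nat_mult)
    have Re_eq: "Re (r * exp w + q * exp (- w) - of_real \<nu> * w) =
        - (Re r * exp y) + (Re (q * exp (- w)) - \<nu> * y)"
      unfolding w(3) by (simp add: y_def)
    have "norm (hankel_kernel n r q \<nu> w) = norm w ^ n * (exp (- (Re r * exp y)) * exp (Re (q * exp (- w)) - \<nu> * y))"
      unfolding hankel_kernel_def norm_mult norm_power norm_minus_cancel norm_exp_eq_Re Re_eq
        exp_add[symmetric] ..
    also have "\<dots> \<le> (fact n * exp (y + pi)) * ((fact m / Re r ^ m * exp (- (real m * y))) * exp (norm q - \<nu> * y))"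
      using pow r q assms by (intro mult_mono) auto
    also have "\<dots> = fact n * (fact m / Re r ^ m) * exp (norm q - \<nu> * y + (y + pi) - real m * y)"
      by (simp add: exp_add exp_diff exp_minus field_simps)
    also have "\<dots> \<le> fact n * (fact m / Re r ^ m) * exp (pi + norm q - y)"
      using lin assms by (intro mult_left_mono) auto
    also have "\<dots> = K * exp (- Re w)"
      by (simp add: K_def y_def exp_diff exp_minus field_simps)
    finally show ?thesis .
  qed
  then show ?thesis
    by blast
qed

lemma exp_add_i_pi: "exp (of_real y + \<i> * of_real pi) = - of_real (exp y)"
  and exp_diff_i_pi: "exp (of_real y - \<i> * of_real pi) = - of_real (exp y)"
  by (simp_all add: exp_add exp_diff mult.commute exp_of_real)

lemma continuous_on_hankel_kernel: "continuous_on S (hankel_kernel n r q \<nu>)"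
  unfolding hankel_kernel_def by (intro continuous_intros)

lemma hankel_integrable_kernel:
  assumes "Re r > 0"
  shows "hankel_integrable (hankel_kernel n r q \<nu>)"
proof -
  let ?f = "hankel_kernel n r q \<nu>"
  have cont: "continuous_on S (\<lambda>x. ?f (g x))" if "continuous_on S g" for S :: "real set" and g
    using continuous_on_compose2[OF continuous_on_hankel_kernel[of UNIV] that] by auto
  obtain K where K: "\<And>w. Re w \<ge> 0 \<Longrightarrow> \<bar>Im w\<bar> \<le> pi \<Longrightarrow> exp w = - of_real (exp (Re w)) \<Longrightarrow>
      norm (?f w) \<le> K * exp (- Re w)"
    using hankel_kernel_bound[OF assms] by meson
  have ray: "set_integrable lborel {0..} (\<lambda>x. ?f (g x))"
    if "continuous_on {0..} g" "\<And>x. x \<ge> 0 \<Longrightarrow> norm (?f (g x)) \<le> K * exp (- x)" for g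
  proof (rule set_integrable_bound)
    show "set_integrable lborel {0..} (\<lambda>x. K * exp (- x))"
      using set_integrable_exp_minus by simp
    show "set_borel_measurable lborel {0..} (\<lambda>x. ?f (g x))"
      using borel_measurable_continuous_on_indicator[OF _ cont[OF that(1)]]
      by (simp add: set_borel_measurable_def)
    show "AE x in lborel. x \<in> {0..} \<longrightarrow> norm (?f (g x)) \<le> norm (K * exp (- x))"
      using that(2) by (auto intro!: AE_I2 order_trans[OF _ abs_ge_self])
  qed
  show ?thesis
    unfolding hankel_integrable_def
  proof (intro conjI borel_integrable_atLeastAtMost' cont ray continuous_intros)
    show "norm (?f (of_real x + \<i> * of_real pi)) \<le> K * exp (- x)"
      and "norm (?f (of_real x - \<i> * of_real pi)) \<le> K * exp (- x)" if "x \<ge> 0" for x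
      using K[of "of_real x + \<i> * of_real pi"] K[of "of_real x - \<i> * of_real pi"] that
      by (simp_all add: exp_add_i_pi exp_diff_i_pi)
  qed
qed

lemma hankel_kernel_tendsto_0:
  assumes "Re r > 0"
  shows "((\<lambda>x. hankel_kernel n r q \<nu> (of_real x + \<i> * of_real pi)) \<longlongrightarrow> 0) at_top"
    and "((\<lambda>x. hankel_kernel n r q \<nu> (of_real x - \<i> * of_real pi)) \<longlongrightarrow> 0) at_top"
proof -
  obtain K where K: "\<And>w. Re w \<ge> 0 \<Longrightarrow> \<bar>Im w\<bar> \<le> pi \<Longrightarrow> exp w = - of_real (exp (Re w)) \<Longrightarrow>
      norm (hankel_kernel n r q \<nu> w) \<le> K * exp (- Re w)"
    using hankel_kernel_bound[OF assms] by meson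
  have "((\<lambda>x. exp (- x)) \<longlongrightarrow> (0::real)) at_top"
    by (intro filterlim_compose[OF exp_at_bot] filterlim_uminus_at_bot_at_top)
  from tendsto_mult_right_zero[OF this]
  have lim: "((\<lambda>x. K * exp (- x)) \<longlongrightarrow> 0) at_top" .
  have bound: "norm (hankel_kernel n r q \<nu> (of_real x + \<i> * of_real pi)) \<le> K * exp (- x)"
    "norm (hankel_kernel n r q \<nu> (of_real x - \<i> * of_real pi)) \<le> K * exp (- x)" if "x \<ge> 0" for x
    using K[of "of_real x + \<i> * of_real pi"] K[of "of_real x - \<i> * of_real pi"] that
    by (simp_all add: exp_add_i_pi exp_diff_i_pi)
  show "((\<lambda>x. hankel_kernel n r q \<nu> (of_real x + \<i> * of_real pi)) \<longlongrightarrow> 0) at_top"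
    and "((\<lambda>x. hankel_kernel n r q \<nu> (of_real x - \<i> * of_real pi)) \<longlongrightarrow> 0) at_top"
    by (rule Lim_null_comparison[OF _ lim], rule eventually_mono[OF eventually_ge_at_top[of 0]],
        erule bound)+
qed

lemma hankel_kernel_mult_exp: "hankel_kernel n r q \<nu> w * exp w = hankel_kernel n r q (\<nu> - 1) w"
  unfolding hankel_kernel_def mult.assoc exp_add[symmetric] by (simp add: algebra_simps)

lemma hankel_kernel_mult_exp_minus_power:
  "hankel_kernel n r q \<nu> w * exp (- w) ^ k = hankel_kernel n r q (\<nu> + real k) w"
  unfolding hankel_kernel_def mult.assoc exp_add[symmetric] exp_of_nat_mult[symmetric]
  by (simp add: algebra_simps)

lemma hankel_kernel_mult_minus: "hankel_kernel n r q \<nu> w * (- w) = hankel_kernel (Suc n) r q \<nu> w"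
  by (simp add: hankel_kernel_def mult_ac)

section \<open>Dependence of the integral with \<open>q = 0\<close> on \<open>r\<close>\<close>

text \<open>The difference of the two sides integrates the \<open>w\<close>-derivative of
  \<open>hankel_kernel 0 r 0 \<nu>\<close>, which vanishes at both ends of the contour.\<close>

lemma hankel_integral_kernel_recurrence:
  assumes "Re r > 0"
  shows "r * hankel_integral (hankel_kernel 0 r 0 (\<nu> - 1)) = of_real \<nu> * hankel_integral (hankel_kernel 0 r 0 \<nu>)"
proof -
  let ?f' = "\<lambda>w. r * hankel_kernel 0 r 0 (\<nu> - 1) w + (- of_real \<nu>) * hankel_kernel 0 r 0 \<nu> w"
  have int: "hankel_integrable (\<lambda>w. c * hankel_kernel 0 r 0 \<mu> w)" for c \<mu>
    by (intro hankel_integrable_cmult hankel_integrable_kernel assms)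
  have "hankel_integral ?f' = 0"
  proof (rule hankel_integral_deriv_eq_0[where f = "hankel_kernel 0 r 0 \<nu>"])
    show "(hankel_kernel 0 r 0 \<nu> has_field_derivative ?f' w) (at w)" for w
      unfolding hankel_kernel_mult_exp[symmetric] unfolding hankel_kernel_def
      by (auto intro!: derivative_eq_intros simp: algebra_simps)
    show "continuous_on UNIV ?f'"
      by (intro continuous_intros continuous_on_hankel_kernel)
    show "hankel_integrable ?f'"
      by (intro hankel_integrable_add int)
  qed (intro hankel_kernel_tendsto_0 assms)+
  then show ?thesis
    unfolding hankel_integral_add[OF int int] hankel_integral_cmult by simp
qed

text \<open>Differentiation under the integral is available for a real parameter, so the complex
  \<open>r\<close> is moved along a line. The derivative brings down \<open>b * exp w\<close>, and
  \<open>exp w\<close> lowers \<open>\<nu>\<close> by 1.\<close>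

lemma has_vector_derivative_hankel_integral_kernel_line:
  assumes "Re (a + b * of_real \<tau>) > 0"
  shows "((\<lambda>\<tau>. hankel_integral (hankel_kernel 0 (a + b * of_real \<tau>) 0 \<nu>)) has_vector_derivative
    b * hankel_integral (hankel_kernel 0 (a + b * of_real \<tau>) 0 (\<nu> - 1))) (at \<tau>)"
proof -
  \<comment> \<open>Within distance \<open>\<delta>\<close> of \<open>\<tau>\<close> the real part
    of \<open>a + b * \<mu>\<close> drops by at most half of its value at \<open>\<tau>\<close>, so
    it stays positive. The \<open>+ 1\<close> keeps the denominator nonzero when
    \<open>Re b = 0\<close>.\<close>
  define \<delta> where "\<delta> = Re (a + b * of_real \<tau>) / (2 * (\<bar>Re b\<bar> + 1))"
  have "\<delta> > 0"
    using assms by (simp add: \<delta>_def)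
  have cancel: "c * (x / (2 * c)) = x / 2" if "c \<noteq> 0" for c x :: real
    using that by simp
  have pos: "Re (a + b * of_real \<mu>) > 0" if "\<bar>\<mu> - \<tau>\<bar> \<le> \<delta>" for \<mu>
  proof -
    have "\<bar>Re b * (\<mu> - \<tau>)\<bar> \<le> (\<bar>Re b\<bar> + 1) * \<delta>"
      unfolding abs_mult using that by (intro mult_mono) auto
    also have "\<dots> = Re (a + b * of_real \<tau>) / 2"
      unfolding \<delta>_def using abs_ge_zero[of "Re b"] by (intro cancel) linarith
    finally have "- (Re b * (\<mu> - \<tau>)) \<le> Re (a + b * of_real \<tau>) / 2"
      by (rule abs_le_D2)
    moreover have "Re (a + b * of_real \<mu>) = Re (a + b * of_real \<tau>) + Re b * (\<mu> - \<tau>)"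
      by (simp add: algebra_simps)
    ultimately show ?thesis
      using assms by linarith
  qed
  have eq: "hankel_kernel 0 a 0 \<nu> w * exp (b * exp w * of_real \<mu>) = hankel_kernel 0 (a + b * of_real \<mu>) 0 \<nu> w"
    for w \<mu>
    unfolding hankel_kernel_def mult.assoc exp_add[symmetric] by (simp add: algebra_simps)
  have eq': "hankel_kernel 0 a 0 \<nu> w * (b * exp w) * exp (b * exp w * of_real \<mu>) =
      b * hankel_kernel 0 (a + b * of_real \<mu>) 0 (\<nu> - 1) w" for w \<mu>
    unfolding hankel_kernel_mult_exp[symmetric] eq[symmetric] by (simp only: mult_ac)
  have "((\<lambda>\<mu>. hankel_integral (\<lambda>w. hankel_kernel 0 a 0 \<nu> w * exp (b * exp w * of_real \<mu>)))
      has_vector_derivative hankel_integral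
        (\<lambda>w. hankel_kernel 0 a 0 \<nu> w * (b * exp w) * exp (b * exp w * of_real \<tau>))) (at \<tau>)"
    using \<open>\<delta> > 0\<close>
    by (rule has_vector_derivative_hankel_integral_exp)
      (auto simp only: eq eq' intro!: hankel_integrable_kernel hankel_integrable_cmult pos)
  then show ?thesis
    unfolding eq eq' hankel_integral_cmult .
qed

text \<open>The segment from 1 to \<open>r\<close> stays in the right half-plane. Along it the
  integral times the power with exponent \<open>- \<nu>\<close> has derivative zero, by the
  recurrence, so its values at the two endpoints agree.\<close>

lemma hankel_integral_kernel_eq_powr:
  assumes "Re r > 0"
  shows "hankel_integral (hankel_kernel 0 r 0 \<nu>) = hankel_integral (hankel_kernel 0 1 0 \<nu>) * r powr of_real \<nu>"
proof -
  have powr_minus_1: "z powr (a - 1) = z powr a / z" if "z \<noteq> 0" for z a :: complex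
    using that by (simp add: powr_diff)
  have eq_div: "x = y / z" if "z * x = y" "z \<noteq> 0" for x y z :: complex
    using that by auto
  have alg: "p * (c * (v * h / z)) + c * (- v * (p / z)) * h = 0" for p c v h z :: complex
    by simp
  let ?r = "\<lambda>\<tau>. 1 + (r - 1) * complex_of_real \<tau>"
  let ?H = "\<lambda>\<nu> \<tau>. hankel_integral (hankel_kernel 0 (?r \<tau>) 0 \<nu>)"
  have pos: "Re (?r \<tau>) > 0" if "\<tau> \<in> {0..1}" for \<tau>
  proof -
    have "(1 - \<tau>) + Re r * \<tau> > 0"
      using that assms by (cases "\<tau> = 0") (auto intro: add_nonneg_pos)
    then show ?thesis
      by (simp add: algebra_simps)
  qed
  have "((\<lambda>\<tau>. ?r \<tau> powr (- of_real \<nu>) * ?H \<nu> \<tau>) has_vector_derivative 0) (at \<tau> within {0..1})"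
    if "\<tau> \<in> {0..1}" for \<tau>
  proof -
    have nz: "?r \<tau> \<notin> \<real>\<^sub>\<le>\<^sub>0" "?r \<tau> \<noteq> 0"
      using pos[OF that] by (auto simp: complex_nonpos_Reals_iff simp del: plus_complex.sel times_complex.sel)
    have powr: "((\<lambda>\<tau>. ?r \<tau> powr (- of_real \<nu>)) has_vector_derivative
        (r - 1) * (- of_real \<nu> * ?r \<tau> powr (- of_real \<nu> - 1))) (at \<tau> within {0..1})"
      by (intro has_vector_derivative_affine_comp has_field_derivative_powr nz)
    have H: "(?H \<nu> has_vector_derivative (r - 1) * ?H (\<nu> - 1) \<tau>) (at \<tau> within {0..1})"
      using pos[OF that] by (rule has_vector_derivative_at_within[OF has_vector_derivative_hankel_integral_kernel_line])
    have rec: "?H (\<nu> - 1) \<tau> = of_real \<nu> * ?H \<nu> \<tau> / ?r \<tau>"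
      by (rule eq_div[OF hankel_integral_kernel_recurrence[OF pos[OF that]] nz(2)])
    have "?r \<tau> powr (- of_real \<nu>) * ((r - 1) * ?H (\<nu> - 1) \<tau>) +
        (r - 1) * (- of_real \<nu> * ?r \<tau> powr (- of_real \<nu> - 1)) * ?H \<nu> \<tau> = 0"
      unfolding rec powr_minus_1[OF nz(2)] by (rule alg)
    with has_vector_derivative_mult[OF powr H] show ?thesis
      by (simp only:)
  qed
  from has_vector_derivative_zero_constant[OF _ this]
  obtain c where c: "\<And>\<tau>. \<tau> \<in> {0..1} \<Longrightarrow> ?r \<tau> powr (- of_real \<nu>) * ?H \<nu> \<tau> = c"
    by blast
  have "r \<noteq> 0"
    using assms by auto
  have "r powr (- of_real \<nu>) * hankel_integral (hankel_kernel 0 r 0 \<nu>) = hankel_integral (hankel_kernel 0 1 0 \<nu>)"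
    using c[of 0] c[of 1] by simp
  moreover have "r powr of_real \<nu> * r powr (- of_real \<nu>) = 1"
    using \<open>r \<noteq> 0\<close> by (simp flip: powr_add)
  ultimately show ?thesis
    by (metis mult.assoc mult.commute mult_1)
qed

section \<open>The constant at \<open>r = 1\<close> as a reciprocal Gamma value\<close>

text \<open>Euler's integral after the substitution of \<open>exp y\<close> for the variable of
  integration.\<close>

lemma Gamma_integral_exp:
  fixes s :: real
  assumes "s > 0"
  shows "integrable lborel (\<lambda>y. exp (s * y - exp y))" "(LBINT y. exp (s * y - exp y)) = Gamma s"
proof -
  let ?f = "\<lambda>t. t powr (s - 1) / exp t"
  \<comment> \<open>Dropping the null point 0 makes the domain equal to the range of
    \<open>exp\<close>.\<close>
  have int: "(?f has_integral Gamma s) {0<..}"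
    using Gamma_integral_real[OF assms]
    by (rule has_integral_spike_set_eq[THEN iffD1, rotated -1]) (auto intro: negligible_subset[of "{0}"])
  then have abs: "?f absolutely_integrable_on {0<..}"
    by (intro nonnegative_absolutely_integrable_1) (auto simp: integrable_on_def)
  have "range exp = {0::real<..}"
    using exp_gt_zero by (auto simp: image_iff) (metis exp_ln)
  moreover have "?f absolutely_integrable_on range exp \<and> integral (range exp) ?f = Gamma s \<longleftrightarrow>
      (\<lambda>y. \<bar>exp y\<bar> * ?f (exp y)) absolutely_integrable_on UNIV \<and>
      integral UNIV (\<lambda>y. \<bar>exp y\<bar> * ?f (exp y)) = Gamma s"
    by (rule has_absolute_integral_change_of_variables_1'[symmetric])
      (auto intro!: derivative_eq_intros simp: inj_on_def)
  moreover have "\<bar>exp y\<bar> * ?f (exp y) = exp (s * y - exp y)" for y :: real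
    by (simp add: powr_def exp_diff algebra_simps)
  ultimately have *: "(\<lambda>y. exp (s * y - exp y)) absolutely_integrable_on UNIV"
    "integral UNIV (\<lambda>y. exp (s * y - exp y)) = Gamma s"
    using abs integral_unique[OF int] by simp_all
  show int': "integrable lborel (\<lambda>y. exp (s * y - exp y))"
    using *(1) unfolding set_integrable_def by (subst (asm) integrable_completion) auto
  show "(LBINT y. exp (s * y - exp y)) = Gamma s"
    using integral_lborel[OF int'] *(2) by simp
qed

text \<open>This is the limit of the ray contribution as \<open>r = exp (- m)\<close> tends to 0,
  the prefactor being \<open>r\<close> to the power \<open>s\<close>. Translation by
  \<open>m\<close> turns it into the integral of the previous lemma over \<open>{- m..}\<close>, and
  these half-lines exhaust the real line.\<close>

lemma shifted_Gamma_integral_tendsto: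
  fixes s :: real
  assumes "s > 0"
  shows "(\<lambda>m. exp (- (s * real m)) * (LBINT y:{0..}. exp (s * y - exp (- real m) * exp y))) \<longlonglongrightarrow> Gamma s"
proof -
  let ?g = "\<lambda>y. exp (s * y - exp y)"
  have "(\<lambda>m. LBINT y:{- real m..}. ?g y) \<longlonglongrightarrow> (LBINT y. ?g y)"
    unfolding set_lebesgue_integral_def
  proof (rule integral_dominated_convergence[where w = ?g])
    show "AE y in lborel. (\<lambda>m. indicator {- real m..} y *\<^sub>R ?g y) \<longlonglongrightarrow> ?g y"
    proof (rule AE_I2)
      fix y :: real
      have "\<forall>\<^sub>F m in sequentially. - y \<le> real m"
        using filterlim_real_sequentially by (simp add: filterlim_at_top)
      then have "\<forall>\<^sub>F m in sequentially. indicator {- real m..} y *\<^sub>R ?g y = ?g y"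
        by eventually_elim auto
      then show "(\<lambda>m. indicator {- real m..} y *\<^sub>R ?g y) \<longlonglongrightarrow> ?g y"
        by (rule tendsto_eventually)
    qed
    show "AE y in lborel. norm (indicator {- real m..} y *\<^sub>R ?g y) \<le> ?g y" for m
      by (auto simp: indicator_def)
  qed (use Gamma_integral_exp(1)[OF assms] in auto)
  moreover have "(LBINT y:{- real m..}. ?g y) =
      exp (- (s * real m)) * (LBINT y:{0..}. exp (s * y - exp (- real m) * exp y))" for m
  proof -
    have *: "(LBINT y:{- real m..}. ?g y) = (LBINT y. indicator {0..} y *\<^sub>R ?g (- real m + y))"
      unfolding set_lebesgue_integral_def
      by (subst lborel_integral_real_affine[where c = 1 and t = "- real m"])
        (auto intro!: Bochner_Integration.integral_cong simp: indicator_def)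
    have "?g (- real m + y) = exp (- (s * real m)) * exp (s * y - exp (- real m) * exp y)" for y
      unfolding exp_add[symmetric] by (simp add: algebra_simps)
    then have "(LBINT y. indicator {0..} y *\<^sub>R ?g (- real m + y)) =
        (LBINT y:{0..}. exp (- (s * real m)) * exp (s * y - exp (- real m) * exp y))"
      unfolding set_lebesgue_integral_def by (simp only:)
    with * show ?thesis
      by simp
  qed
  ultimately show ?thesis
    using Gamma_integral_exp(2)[OF assms] by simp
qed

text \<open>On the segments the integrand converges boundedly as \<open>r = exp (- m)\<close> tends
  to 0, so for \<open>s > 0\<close> the vanishing prefactor kills the contribution. For
  \<open>s = 0\<close> the prefactor is 1 and the integrand tends to 1, which leaves the length
  \<open>pi\<close>.\<close>

lemma hankel_arc_tendsto:
  fixes b :: complex and s :: real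
  assumes b: "Re b = 0" and s: "s \<ge> 0"
  shows "(\<lambda>m. exp (- (of_real s * of_nat m)) *
      (LBINT x:{0..pi}. hankel_kernel 0 (of_real (exp (- real m))) 0 (- s) (b * of_real x)))
    \<longlonglongrightarrow> (if s = 0 then of_real pi else 0)"
proof -
  let ?f = "\<lambda>m x. hankel_kernel 0 (of_real (exp (- real m))) 0 (- s) (b * of_real x)"
  have r_lim: "(\<lambda>m. exp (- real m)) \<longlonglongrightarrow> 0"
    by (intro filterlim_compose[OF exp_at_bot] filterlim_uminus_at_bot_at_top[THEN filterlim_compose]
        filterlim_real_sequentially)
  have "(\<lambda>m. LBINT x:{0..pi}. ?f m x) \<longlonglongrightarrow> (LBINT x:{0..pi}. exp (of_real s * (b * of_real x)))"
    unfolding set_lebesgue_integral_def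
  proof (rule integral_dominated_convergence[where w = "\<lambda>x. indicator {0..pi} x * exp 1"])
    show "integrable lborel (\<lambda>x. indicator {0..pi} x * exp 1 :: real)"
      by simp
    show "AE x in lborel. (\<lambda>m. indicator {0..pi} x *\<^sub>R ?f m x)
        \<longlonglongrightarrow> indicator {0..pi} x *\<^sub>R exp (of_real s * (b * of_real x))"
    proof (rule AE_I2)
      fix x :: real
      have "(\<lambda>m. exp (of_real (exp (- real m)) * exp (b * of_real x) + of_real s * (b * of_real x)))
          \<longlonglongrightarrow> exp (of_real 0 * exp (b * of_real x) + of_real s * (b * of_real x))"
        by (intro tendsto_intros r_lim)
      then show "(\<lambda>m. indicator {0..pi} x *\<^sub>R ?f m x)
        \<longlonglongrightarrow> indicator {0..pi} x *\<^sub>R exp (of_real s * (b * of_real x))"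
        by (intro tendsto_scaleR tendsto_const) (simp add: hankel_kernel_def)
    qed
    show "AE x in lborel. norm (indicator {0..pi} x *\<^sub>R ?f m x) \<le> indicator {0..pi} x * exp 1" for m
    proof (rule AE_I2)
      fix x :: real
      have "exp (- real m) * Re (exp (b * of_real x)) \<le> 1 * 1"
        using b complex_Re_le_cmod[of "exp (b * of_real x)"]
        by (intro order_trans[OF mult_left_mono[of _ 1] mult_right_mono]) auto
      then have "norm (?f m x) \<le> exp 1"
        using b by (simp add: hankel_kernel_def)
      then show "norm (indicator {0..pi} x *\<^sub>R ?f m x) \<le> indicator {0..pi} x * exp 1"
        by (auto simp: indicator_def)
    qed
    show "(\<lambda>x. indicator {0..pi} x *\<^sub>R exp (of_real s * (b * of_real x))) \<in> borel_measurable lborel"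
      by measurable
    show "(\<lambda>x. indicator {0..pi} x *\<^sub>R ?f m x) \<in> borel_measurable lborel" for m
      unfolding hankel_kernel_def by measurable
  qed
  moreover have "(\<lambda>m. exp (- (of_real s * of_nat m))) \<longlonglongrightarrow> (if s = 0 then 1 else 0 :: complex)"
  proof (cases "s = 0")
    case False
    then have "(\<lambda>m. exp (- s) ^ m) \<longlonglongrightarrow> 0"
      using s by (intro LIMSEQ_power_zero) auto
    then have "(\<lambda>m. complex_of_real (exp (- s) ^ m)) \<longlonglongrightarrow> of_real 0"
      by (intro tendsto_of_real)
    then show ?thesis
      using False by (simp add: exp_of_real[symmetric] exp_of_nat_mult[symmetric] mult.commute)
  qed simp
  ultimately have "(\<lambda>m. exp (- (of_real s * of_nat m)) * (LBINT x:{0..pi}. ?f m x)) \<longlonglongrightarrow>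
      (if s = 0 then 1 else 0) * (LBINT x:{0..pi}. exp (of_real s * (b * of_real x)))"
    by (intro tendsto_mult)
  moreover have "(LBINT x:{0..pi}. (1::complex)) = of_real pi"
    unfolding set_lebesgue_integral_def by (simp add: scaleR_conv_of_real)
  ultimately show ?thesis
    by (simp split: if_splits)
qed

text \<open>\<open>exp w\<close> takes the same values on both rays, so only the phases
  \<open>cis (pi * s)\<close> and \<open>cis (- (pi * s))\<close> of \<open>exp (s * w)\<close>
  differ, and their difference produces the sine.\<close>

lemma hankel_integral_kernel_ray:
  fixes r s :: real
  assumes "r > 0"
  shows "(LBINT y:{0..}. hankel_kernel 0 (of_real r) 0 (- s) (of_real y + \<i> * of_real pi)) -
      (LBINT y:{0..}. hankel_kernel 0 (of_real r) 0 (- s) (of_real y - \<i> * of_real pi)) =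
    2 * \<i> * of_real (sin (pi * s)) * of_real (LBINT y:{0..}. exp (s * y - r * exp y))"
proof -
  have plus: "hankel_kernel 0 (of_real r) 0 (- s) (of_real y + \<i> * of_real pi) =
      cis (pi * s) * of_real (exp (s * y - r * exp y))" for y
    unfolding hankel_kernel_def exp_add_i_pi cis_conv_exp exp_of_real[symmetric] exp_add[symmetric]
    by (simp add: algebra_simps exp_of_real)
  have minus: "hankel_kernel 0 (of_real r) 0 (- s) (of_real y - \<i> * of_real pi) =
      cis (- (pi * s)) * of_real (exp (s * y - r * exp y))" for y
    unfolding hankel_kernel_def exp_diff_i_pi cis_conv_exp exp_of_real[symmetric] exp_add[symmetric]
    by (simp add: algebra_simps exp_of_real)
  have "cis (pi * s) - cis (- (pi * s)) = 2 * \<i> * of_real (sin (pi * s))"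
    by (simp add: complex_eq_iff)
  then show ?thesis
    unfolding plus minus by (simp add: set_integral_complex_of_real flip: left_diff_distrib)
qed

text \<open>By the power law the constant can be computed from any \<open>r = exp (- m)\<close>, so
  it equals the limit over \<open>m\<close>. For \<open>s > 0\<close> only the rays survive and give
  \<open>sin (pi * s) * Gamma s / pi\<close>, which the reflection formula identifies; for
  \<open>s = 0\<close> only the segments survive and give 1.\<close>

lemma hankel_integral_kernel_1_base:
  assumes "0 \<le> s" "s < 1"
  shows "hankel_integral (hankel_kernel 0 1 0 (- s)) = rGamma (of_real (1 - s))"
proof -
  let ?r = "\<lambda>m. complex_of_real (exp (- real m))"
  let ?k = "\<lambda>m. hankel_kernel 0 (?r m) 0 (- s)"
  let ?e = "\<lambda>m. exp (- (of_real s * of_nat m)) :: complex"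
  let ?arc = "\<lambda>b m. ?e m * (LBINT x:{0..pi}. ?k m (b * of_real x))"
  let ?ray = "\<lambda>m. exp (- (s * real m)) * (LBINT y:{0..}. exp (s * y - exp (- real m) * exp y))"
  \<comment> \<open>The left side does not involve \<open>m\<close>, so the right side is a constant
    sequence and its limit is its value.\<close>
  have const: "hankel_integral (hankel_kernel 0 1 0 (- s)) =
      (\<i> * ?arc \<i> m + \<i> * ?arc (- \<i>) m + 2 * \<i> * of_real (sin (pi * s) * ?ray m)) / (2 * of_real pi * \<i>)" for m
  proof -
    have e_eq: "?e m = of_real (exp (- (s * real m)))"
      by (simp add: exp_of_real[symmetric])
    have powr: "?r m powr of_real (- s) * ?e m = 1"
      by (simp add: powr_def Ln_of_real mult.commute flip: exp_add exp_of_real)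
    have "hankel_integral (?k m) * ?e m =
        hankel_integral (hankel_kernel 0 1 0 (- s)) * (?r m powr of_real (- s) * ?e m)"
      by (subst hankel_integral_kernel_eq_powr) (simp_all only: mult.assoc Re_complex_of_real exp_gt_zero)
    then have "hankel_integral (hankel_kernel 0 1 0 (- s)) = ?e m * hankel_integral (?k m)"
      unfolding powr by (metis mult.commute mult.right_neutral)
    also have "\<dots> = ?e m * ((\<i> * (LBINT x:{0..pi}. ?k m (\<i> * of_real x)) + \<i> * (LBINT x:{0..pi}. ?k m (- \<i> * of_real x)) +
        2 * \<i> * of_real (sin (pi * s)) * of_real (LBINT y:{0..}. exp (s * y - exp (- real m) * exp y))) / (2 * of_real pi * \<i>))"
      unfolding hankel_integral_def hankel_integral_kernel_ray[OF exp_gt_zero, symmetric] by simp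
    also have "\<dots> = (\<i> * ?arc \<i> m + \<i> * ?arc (- \<i>) m + 2 * \<i> * of_real (sin (pi * s) * ?ray m)) / (2 * of_real pi * \<i>)"
      unfolding e_eq by (simp only: distrib_left times_divide_eq_right of_real_mult mult_ac)
    finally show ?thesis .
  qed
  have arc: "?arc b \<longlonglongrightarrow> (if s = 0 then of_real pi else 0)" if "Re b = 0" for b
    using hankel_arc_tendsto[OF that assms(1)] .
  have ray: "(\<lambda>m. sin (pi * s) * ?ray m) \<longlonglongrightarrow> (if s = 0 then 0 else sin (pi * s) * Gamma s)"
  proof (cases "s = 0")
    case False
    then show ?thesis
      using assms shifted_Gamma_integral_tendsto[of s] by (auto intro: tendsto_mult_left)
  qed simp
  have "(\<lambda>m. (\<i> * ?arc \<i> m + \<i> * ?arc (- \<i>) m + 2 * \<i> * of_real (sin (pi * s) * ?ray m)) / (2 * of_real pi * \<i>))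
      \<longlonglongrightarrow> (\<i> * (if s = 0 then of_real pi else 0) + \<i> * (if s = 0 then of_real pi else 0) +
        2 * \<i> * of_real (if s = 0 then 0 else sin (pi * s) * Gamma s)) / (2 * of_real pi * \<i>)"
    by (intro tendsto_intros arc ray) auto
  then have "hankel_integral (hankel_kernel 0 1 0 (- s)) =
      (\<i> * (if s = 0 then of_real pi else 0) + \<i> * (if s = 0 then of_real pi else 0) +
        2 * \<i> * of_real (if s = 0 then 0 else sin (pi * s) * Gamma s)) / (2 * of_real pi * \<i>)"
    unfolding const[symmetric] by (simp only: LIMSEQ_const_iff)
  also have "\<dots> = rGamma (of_real (1 - s))"
  proof (cases "s = 0")
    case False
    then have "s > 0"
      using assms by simp
    then have "Gamma s \<noteq> 0"
      by (metis Gamma_real_pos less_irrefl)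
    then have inv: "complex_of_real (Gamma s) * rGamma (of_real s) = 1"
      by (simp add: rGamma_inverse_Gamma Gamma_complex_of_real)
    have sin: "sin (of_real pi * complex_of_real s) = of_real (sin (pi * s))"
      by (simp flip: sin_of_real)
    have "rGamma (of_real (1 - s)) = complex_of_real (Gamma s) * rGamma (of_real s) * rGamma (1 - of_real s)"
      unfolding inv by simp
    also have "\<dots> = of_real (Gamma s) * (of_real (sin (pi * s)) / of_real pi)"
      unfolding mult.assoc rGamma_reflection_complex sin ..
    finally have "rGamma (of_real (1 - s)) = complex_of_real (Gamma s) * (of_real (sin (pi * s)) / of_real pi)" .
    then show ?thesis
      using False by simp
  qed simp
  finally show ?thesis .
qed

text \<open>Both sides satisfy the same recurrence linking \<open>\<nu> - 1\<close> to
  \<open>\<nu>\<close>, which carries the identity from orders in \<open>(-1, 0]\<close> to all real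
  orders.\<close>

lemma hankel_integral_kernel_1: "hankel_integral (hankel_kernel 0 1 0 \<nu>) = rGamma (of_real \<nu> + 1)"
proof -
  let ?c = "\<lambda>\<nu>. hankel_integral (hankel_kernel 0 1 0 \<nu>)"
  let ?P = "\<lambda>\<nu>. ?c \<nu> = rGamma (of_real \<nu> + 1)"
  have rec: "?c (\<nu> - 1) = of_real \<nu> * ?c \<nu>" for \<nu>
    using hankel_integral_kernel_recurrence[of 1 \<nu>] by simp
  have rG: "rGamma (of_real (\<nu> - 1) + 1) = of_real \<nu> * rGamma (complex_of_real \<nu> + 1)" for \<nu>
    using rGamma_plus1[of "complex_of_real \<nu>"] by simp
  have down: "?P (\<nu> - 1)" if "?P \<nu>" for \<nu>
    unfolding rec rG that ..
  have up: "?P \<nu>" if "?P (\<nu> - 1)" "\<nu> \<noteq> 0" for \<nu>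
    using that unfolding rec rG by simp
  \<comment> \<open>Then \<open>- s\<close> lies in \<open>(-1, 0]\<close> and differs from
    \<open>\<nu>\<close> by an integer.\<close>
  define s where "s = of_int \<lceil>\<nu>\<rceil> - \<nu>"
  have s: "0 \<le> s" "s < 1"
    unfolding s_def by linarith+
  have base: "?P (- s)"
    using hankel_integral_kernel_1_base[OF s] by (simp add: add.commute)
  \<comment> \<open>Going up divides by the new order, which is positive at every step because
    \<open>s < 1\<close>.\<close>
  have "?P (- s + real n)" for n
  proof (induction n)
    case (Suc n)
    then show ?case
      using up[of "- s + real (Suc n)"] s by simp
  qed (use base in simp)
  moreover have "?P (- s - real n)" for n
  proof (induction n)
    case (Suc n)
    then show ?case
      using down[of "- s - real n"] by (simp add: algebra_simps)
  qed (use base in simp)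
  moreover have "\<nu> = - s + real (nat \<lceil>\<nu>\<rceil>) \<or> \<nu> = - s - real (nat (- \<lceil>\<nu>\<rceil>))"
    unfolding s_def by linarith
  ultimately show ?thesis
    by metis
qed

section \<open>The Bessel function as a contour integral and its derivatives in the order\<close>

text \<open>Expanding \<open>exp (r * exp (- w))\<close> with \<open>r = t / 2\<close>, the
  \<open>k\<close>-th term raises the order of the kernel to \<open>\<nu> + k\<close>. Its value
  from the power law, times \<open>r ^ k / fact k\<close>, is the \<open>k\<close>-th term of the
  Bessel series.\<close>

lemma bessel_I_eq_hankel_integral:
  assumes "Re t > 0"
  shows "bessel_I (of_real \<nu>) t = hankel_integral (hankel_kernel 0 (t / 2) (t / 2) \<nu>)"
proof -
  define r where "r = t / 2"
  have r: "Re r > 0" "r \<noteq> 0"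
    using assms by (auto simp: r_def)
  have "(\<lambda>k. r ^ k / fact k * hankel_integral (\<lambda>w. hankel_kernel 0 r 0 \<nu> w * exp (- w) ^ k)) sums
      hankel_integral (\<lambda>w. hankel_kernel 0 r 0 \<nu> w * exp (r * exp (- w)))"
    unfolding hankel_kernel_mult_exp_minus_power
    by (rule hankel_integral_exp_sums[where f = "hankel_kernel 0 r 0 \<nu>", unfolded hankel_kernel_mult_exp_minus_power])
      (intro hankel_integrable_kernel r)
  moreover have "hankel_kernel 0 r 0 \<nu> w * exp (r * exp (- w)) = hankel_kernel 0 r r \<nu> w" for w
    unfolding hankel_kernel_def mult.assoc exp_add[symmetric] by (simp add: algebra_simps)
  moreover have "r ^ k / fact k * hankel_integral (hankel_kernel 0 r 0 (\<nu> + real k)) =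
      r powr of_real \<nu> * (r ^ (2 * k) / fact k * rGamma (of_real \<nu> + of_nat k + 1))" for k
    using r unfolding mult_2 power_add by (simp add: hankel_integral_kernel_eq_powr hankel_integral_kernel_1 powr_add powr_nat'
        mult_ac)
  ultimately have sums: "(\<lambda>k. r powr of_real \<nu> * (r ^ (2 * k) / fact k * rGamma (of_real \<nu> + of_nat k + 1))) sums
      hankel_integral (hankel_kernel 0 r r \<nu>)"
    by (simp only: hankel_kernel_mult_exp_minus_power)
  \<comment> \<open>In \<open>bessel_I\<close> the power stands outside the series; cancelling this
    nonzero factor gives summability of the bare series, so that the factor can be pulled out of the
    sum.\<close>
  have "r powr of_real \<nu> \<noteq> 0"
    using r by simp
  then have "summable (\<lambda>k. r ^ (2 * k) / fact k * rGamma (of_real \<nu> + of_nat k + 1))"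
    using sums_summable[OF sums] by (simp only: summable_cmult_iff simp_thms)
  from suminf_mult[OF this, of "r powr of_real \<nu>"] show ?thesis
    using sums_unique[OF sums] by (simp add: bessel_I_def r_def)
qed

lemma has_vector_derivative_hankel_integral_kernel:
  assumes "Re r > 0"
  shows "((\<lambda>\<nu>. hankel_integral (hankel_kernel n r q \<nu>)) has_vector_derivative
    hankel_integral (hankel_kernel (Suc n) r q \<nu>)) (at \<nu>)"
proof -
  have eq: "hankel_kernel n r q 0 w * exp (- w * of_real \<mu>) = hankel_kernel n r q \<mu> w" for n w \<mu>
    unfolding hankel_kernel_def mult.assoc exp_add[symmetric] by (simp add: algebra_simps)
  have "((\<lambda>\<nu>. hankel_integral (\<lambda>w. hankel_kernel n r q 0 w * exp (- w * of_real \<nu>))) has_vector_derivative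
      hankel_integral (\<lambda>w. hankel_kernel n r q 0 w * - w * exp (- w * of_real \<nu>))) (at \<nu>)"
    by (rule has_vector_derivative_hankel_integral_exp[OF zero_less_one])
      (simp_all only: hankel_kernel_mult_minus eq hankel_integrable_kernel assms)
  then show ?thesis
    by (simp only: hankel_kernel_mult_minus eq)
qed

text \<open>Stated as an equality of functions, so that the induction step can differentiate the
  whole previous iterate.\<close>

lemma nth_vector_derivative_bessel_I:
  assumes "Re t > 0"
  shows "nth_vector_derivative n (\<lambda>\<mu>. bessel_I (of_real \<mu>) t) =
    (\<lambda>\<nu>. hankel_integral (hankel_kernel n (t / 2) (t / 2) \<nu>))"
proof (induction n)
  case 0
  show ?case
    using assms by (simp add: nth_vector_derivative_def bessel_I_eq_hankel_integral)
next
  case (Suc n)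
  have "nth_vector_derivative (Suc n) (\<lambda>\<mu>. bessel_I (of_real \<mu>) t) =
      (\<lambda>\<nu>. vector_derivative (\<lambda>\<mu>. hankel_integral (hankel_kernel n (t / 2) (t / 2) \<mu>)) (at \<nu>))"
    unfolding Suc[symmetric] by (simp add: nth_vector_derivative_def)
  also have "\<dots> = (\<lambda>\<nu>. hankel_integral (hankel_kernel (Suc n) (t / 2) (t / 2) \<nu>))"
    using assms by (intro ext vector_derivative_at has_vector_derivative_hankel_integral_kernel) simp
  finally show ?case .
qed

section \<open>Reduction of the contour integral to the two real integrals\<close>

text \<open>At conjugate points of the imaginary axis the two exponentials add up to
  \<open>2 * cos x\<close>. The powers of \<open>-\<i>\<close> and \<open>\<i>\<close> are phases of
  angle \<open>pi / 2 * n\<close>, which merge with those of angle \<open>\<nu> * x\<close> into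
  conjugate phases.\<close>

lemma hankel_kernel_arc:
  "hankel_kernel n (t / 2) (t / 2) \<nu> (\<i> * of_real x) + hankel_kernel n (t / 2) (t / 2) \<nu> (- \<i> * of_real x) =
    2 * (of_real (x ^ n) * exp (t * of_real (cos x)) * of_real (cos (\<nu> * x + pi / 2 * real n)))"
proof -
  define \<theta> where "\<theta> = \<nu> * x + pi / 2 * real n"
  have cos: "exp (\<i> * of_real x) + exp (- (\<i> * of_real x)) = 2 * of_real (cos x)"
    by (simp add: cos_of_real[symmetric] cos_exp_eq)
  have expo: "t / 2 * exp (\<i> * of_real x) + t / 2 * exp (- (\<i> * of_real x)) = t * of_real (cos x)"
    unfolding distrib_left[symmetric] cos by simp
  have "cis (pi / 2) ^ n = cis (pi / 2 * real n)" "cis (- (pi / 2)) ^ n = cis (- (pi / 2 * real n))"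
    unfolding Complex.DeMoivre by (simp_all only: mult.commute mult_minus_left mult_minus_right)
  then have i: "\<i> ^ n = cis (pi / 2 * real n)" and mi: "(- \<i>) ^ n = cis (- (pi / 2 * real n))"
    by (simp_all only: cis_pi_half cis_minus_pi_half)
  have "hankel_kernel n (t / 2) (t / 2) \<nu> (\<i> * of_real x) =
      (- \<i> * of_real x) ^ n * (exp (t * of_real (cos x)) * exp (\<i> * of_real (- (\<nu> * x))))"
    unfolding hankel_kernel_def expo exp_add[symmetric] by (simp add: algebra_simps)
  also have "\<dots> = of_real (x ^ n) * exp (t * of_real (cos x)) * cis (- \<theta>)"
    unfolding power_mult_distrib mi cis_conv_exp[symmetric] \<theta>_def minus_add_distrib cis_mult[symmetric]
    by (simp only: of_real_power mult_ac)
  finally have plus: "hankel_kernel n (t / 2) (t / 2) \<nu> (\<i> * of_real x) =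
      of_real (x ^ n) * exp (t * of_real (cos x)) * cis (- \<theta>)" .
  have "hankel_kernel n (t / 2) (t / 2) \<nu> (- \<i> * of_real x) =
      (\<i> * of_real x) ^ n * (exp (t / 2 * exp (\<i> * of_real x) + t / 2 * exp (- (\<i> * of_real x))) *
        exp (\<i> * of_real (\<nu> * x)))"
    unfolding hankel_kernel_def exp_add[symmetric] by (simp add: algebra_simps)
  also have "\<dots> = of_real (x ^ n) * exp (t * of_real (cos x)) * cis \<theta>"
    unfolding expo unfolding power_mult_distrib i cis_conv_exp[symmetric] \<theta>_def cis_mult[symmetric]
    by (simp only: of_real_power mult_ac)
  finally have minus: "hankel_kernel n (t / 2) (t / 2) \<nu> (- \<i> * of_real x) =
      of_real (x ^ n) * exp (t * of_real (cos x)) * cis \<theta>" .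
  have "cis (- \<theta>) + cis \<theta> = 2 * of_real (cos \<theta>)"
    by (simp add: complex_eq_iff)
  then show ?thesis
    unfolding plus minus distrib_left[symmetric] \<theta>_def by simp
qed

text \<open>The factor \<open>E\<close> containing the complex \<open>t\<close> is common to both
  rays, since \<open>exp w\<close> and \<open>exp (- w)\<close> agree there. The remaining factors
  are \<open>cnj Z\<close> on the upper ray and \<open>Z\<close> on the lower one, so the difference
  leaves the imaginary part of \<open>Z\<close>.\<close>

lemma hankel_kernel_rays:
  "hankel_kernel n (t / 2) (t / 2) \<nu> (of_real y + \<i> * of_real pi) -
     hankel_kernel n (t / 2) (t / 2) \<nu> (of_real y - \<i> * of_real pi) =
   - (2 * \<i>) * (exp (- t * of_real (cosh y) - of_real (\<nu> * y)) *
     of_real (Im ((\<i> * of_real pi - of_real y) ^ n * exp (\<i> * of_real pi * of_real \<nu>))))"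
proof -
  define Z where "Z = (\<i> * of_real pi - of_real y) ^ n * exp (\<i> * of_real pi * of_real \<nu>)"
  define E where "E = exp (- t * of_real (cosh y) - of_real (\<nu> * y))"
  have e: "exp (- (of_real y + \<i> * of_real pi)) = - of_real (exp (- y))"
    "exp (- (of_real y - \<i> * of_real pi)) = - of_real (exp (- y))"
    using exp_diff_i_pi[of "- y"] exp_add_i_pi[of "- y"] by (simp_all add: algebra_simps)
  have cosh: "t / 2 * - of_real (exp y) + t / 2 * - of_real (exp (- y)) = - t * of_real (cosh y)"
    by (simp add: cosh_field_def field_simps)
  have "hankel_kernel n (t / 2) (t / 2) \<nu> (of_real y - \<i> * of_real pi) = Z * E"
    unfolding hankel_kernel_def exp_diff_i_pi e cosh Z_def E_def mult.assoc exp_add[symmetric]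
    by (simp add: algebra_simps)
  moreover have "hankel_kernel n (t / 2) (t / 2) \<nu> (of_real y + \<i> * of_real pi) = cnj Z * E"
    unfolding hankel_kernel_def exp_add_i_pi e cosh Z_def E_def complex_cnj_mult exp_cnj mult.assoc exp_add[symmetric]
    by (simp add: algebra_simps minus_diff_commute)
  moreover have "cnj Z - Z = - (2 * \<i>) * of_real (Im Z)"
    by (simp add: complex_eq_iff)
  ultimately show ?thesis
    unfolding Z_def[symmetric] E_def[symmetric] by (simp only: left_diff_distrib[symmetric]) (simp only: mult_ac)
qed

text \<open>The differentiability and integrability conjuncts guarantee that the iterated derivative
  and the two integrals are genuine, as both operators are total functions.\<close>

theorem mainTheorem3:
  fixes n :: nat and \<nu> :: real and t :: complex
  assumes "Re t > 0"
  shows "(\<forall>k<n. nth_vector_derivative k (\<lambda>\<mu>. bessel_I (of_real \<mu>) t) differentiable (at \<nu>)) \<and>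
    set_integrable lborel {0..pi}
      (\<lambda>x. of_real (x ^ n) * exp (t * of_real (cos x)) * of_real (cos (\<nu> * x + pi / 2 * real n))) \<and>
    set_integrable lborel {0..}
      (\<lambda>x. exp (- t * of_real (cosh x) - of_real (\<nu> * x)) *
           of_real (Im ((\<i> * of_real pi - of_real x) ^ n * exp (\<i> * of_real pi * of_real \<nu>)))) \<and>
    nth_vector_derivative n (\<lambda>\<mu>. bessel_I (of_real \<mu>) t) \<nu> =
      1 / of_real pi *
        (LBINT x:{0..pi}.
          of_real (x ^ n) * exp (t * of_real (cos x)) * of_real (cos (\<nu> * x + pi / 2 * real n))) -
      1 / of_real pi *
        (LBINT x:{0..}.
          exp (- t * of_real (cosh x) - of_real (\<nu> * x)) *
          of_real (Im ((\<i> * of_real pi - of_real x) ^ n * exp (\<i> * of_real pi * of_real \<nu>))))"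
proof -
  let ?k = "hankel_kernel n (t / 2) (t / 2) \<nu>"
  let ?A = "\<lambda>x. of_real (x ^ n) * exp (t * of_real (cos x)) * of_real (cos (\<nu> * x + pi / 2 * real n))"
  let ?B = "\<lambda>x. exp (- t * of_real (cosh x) - of_real (\<nu> * x)) *
    of_real (Im ((\<i> * of_real pi - of_real x) ^ n * exp (\<i> * of_real pi * of_real \<nu>)))"
  have "Re (t / 2) > 0"
    using assms by simp
  then have "hankel_integrable ?k"
    by (rule hankel_integrable_kernel)
  then have int: "set_integrable lborel {0..pi} (\<lambda>x. ?k (\<i> * of_real x))"
    "set_integrable lborel {0..pi} (\<lambda>x. ?k (- \<i> * of_real x))"
    "set_integrable lborel {0..} (\<lambda>x. ?k (of_real x + \<i> * of_real pi))"
    "set_integrable lborel {0..} (\<lambda>x. ?k (of_real x - \<i> * of_real pi))"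
    unfolding hankel_integrable_def by blast+
  \<comment> \<open>The pointwise identities turn integrability of the kernel into integrability of
    \<open>2 * ?A x\<close> and \<open>- (2 * \<i>) * ?B x\<close>; the nonzero constants are
    cancelled below.\<close>
  note arc = set_integral_add[OF int(1,2), unfolded hankel_kernel_arc]
  note rays = set_integral_diff[OF int(3,4), unfolded hankel_kernel_rays]
  have arc_eq: "(LBINT x:{0..pi}. ?k (\<i> * of_real x)) + (LBINT x:{0..pi}. ?k (- \<i> * of_real x)) =
      2 * (LBINT x:{0..pi}. ?A x)"
    by (simp only: arc(2)[symmetric] set_integral_mult_right)
  have rays_eq: "(LBINT x:{0..}. ?k (of_real x + \<i> * of_real pi)) -
      (LBINT x:{0..}. ?k (of_real x - \<i> * of_real pi)) = - (2 * \<i>) * (LBINT x:{0..}. ?B x)"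
    by (simp only: rays(2)[symmetric] set_integral_mult_right)
  have int_A: "set_integrable lborel {0..pi} ?A"
    using arc(1) by (subst (asm) set_integrable_mult_right_iff) simp_all
  have int_B: "set_integrable lborel {0..} ?B"
    using rays(1) by (subst (asm) set_integrable_mult_right_iff) simp_all
  have "hankel_integral ?k = (\<i> * (2 * (LBINT x:{0..pi}. ?A x)) + - (2 * \<i>) * (LBINT x:{0..}. ?B x)) /
      (2 * of_real pi * \<i>)"
    unfolding hankel_integral_def distrib_left[symmetric] add_diff_eq[symmetric] arc_eq rays_eq ..
  also have "\<dots> = 1 / of_real pi * (LBINT x:{0..pi}. ?A x) - 1 / of_real pi * (LBINT x:{0..}. ?B x)"
    by (simp add: field_simps)
  finally have "nth_vector_derivative n (\<lambda>\<mu>. bessel_I (of_real \<mu>) t) \<nu> =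
      1 / of_real pi * (LBINT x:{0..pi}. ?A x) - 1 / of_real pi * (LBINT x:{0..}. ?B x)"
    unfolding nth_vector_derivative_bessel_I[OF assms] .
  moreover have "nth_vector_derivative k (\<lambda>\<mu>. bessel_I (of_real \<mu>) t) differentiable (at \<nu>)" for k
    unfolding nth_vector_derivative_bessel_I[OF assms]
    using has_vector_derivative_hankel_integral_kernel[OF \<open>Re (t / 2) > 0\<close>]
    by (rule differentiableI_vector)
  ultimately show ?thesis
    using int_A int_B by blast
qed

end
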